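(* Let $\mathcal{G}_\infty(\mathcal{B})$ be an infinite braced grid in the Euclidean plane $(\mathbb{R}^2,\|\cdot\|_2)$. Then $\mathcal{G}_\infty(\mathcal{B})$ is infinitesimally rigid if and only if its braces graph is a connected spanning subgraph of $K_{\infty,\infty}$.
   Context: $\mathcal{G}_\infty$ is the infinite bar-joint framework in $\mathbb{R}^2$ with joints at all points of $\mathbb{Z}^2$ and bars joining points at distance 1. For a set $\mathcal{B}$ of diagonals of the unit squares $[j,j+1]\times[k,k+1]$, $j,k\in\mathbb{Z}$, the infinite braced grid $\mathcal{G}_\infty(\mathcal{B})$ is obtained by adding the diagonals in $\mathcal{B}$ as bars (braces). An infinitesimal flex is a vector field $u:\mathbb{Z}^2\to\mathbb{R}^2$ on the joints such that $\langle u(q)-u(q'),q-q'\rangle=0$ for every bar joining joints $q,q'$. The framework is infinitesimally rigid if every infinitesimal flex is a rigid motion flex, that is, of the form $u(q)=a+cJq$ for some $a\in\mathbb{R}^2$ and $c\in\mathbb{R}$, where $J$ is rotation by $\pi/2$. $K_{\infty,\infty}$ is the complete bipartite graph whose two vertex classes are the set of columns $\{j\}$ and the set of rows $\{k\}$ of unit squares, $j,k\in\mathbb{Z}$. The edge joining column $j$ and row $k$ corresponds to the square $[j,j+1]\times[k,k+1]$. The braces graph of $\mathcal{G}_\infty(\mathcal{B})$ is the subgraph of $K_{\infty,\infty}$ consisting of the edges corresponding to squares with at least one brace, together with their end vertices. It is spanning if it contains every vertex of $K_{\infty,\infty}$. *)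

theory Defs
  imports "HOL-Analysis.Analysis" "Graph_Theory.Digraph_Component"
begin

section \<open>Infinite braced grids\<close>

text \<open>
  Joints are indexed by \<open>int \<times> int\<close> and placed in the Euclidean plane by \<open>point\<close>;
  a bar is the unordered pair \<open>{q, q'}\<close> of the joints that it connects.
\<close>

type_synonym joint = "int \<times> int"
type_synonym bar = "joint set"

definition point :: "joint \<Rightarrow> real ^ 2" where
  "point q = vector [of_int (fst q), of_int (snd q)]"

definition grid_bars :: "bar set" where
  "grid_bars = {{q, q'} | q q'. dist (point q) (point q') = 1}"

definition diagonals :: "int \<Rightarrow> int \<Rightarrow> bar set" where
  "diagonals j k = {{(j, k), (j + 1, k + 1)}, {(j + 1, k), (j, k + 1)}}"

definition braced_grid :: "bar set \<Rightarrow> bar set" where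
  "braced_grid B = grid_bars \<union> B"


section \<open>Infinitesimal rigidity\<close>

definition infinitesimal_flex :: "bar set \<Rightarrow> (joint \<Rightarrow> real ^ 2) \<Rightarrow> bool" where
  "infinitesimal_flex E u \<longleftrightarrow>
     (\<forall>q q'. {q, q'} \<in> E \<longrightarrow> (u q - u q') \<bullet> (point q - point q') = 0)"

definition rot90 :: "real ^ 2 \<Rightarrow> real ^ 2" where
  "rot90 x = vector [- (x $ 2), x $ 1]"

definition rigid_motion_flex :: "(joint \<Rightarrow> real ^ 2) \<Rightarrow> bool" where
  "rigid_motion_flex u \<longleftrightarrow> (\<exists>a c. \<forall>q. u q = a + c *\<^sub>R rot90 (point q))"

definition infinitesimally_rigid :: "bar set \<Rightarrow> bool" where
  "infinitesimally_rigid E \<longleftrightarrow> (\<forall>u. infinitesimal_flex E u \<longrightarrow> rigid_motion_flex u)"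


section \<open>The braces graph\<close>

datatype strip = Col int | Row int

text \<open>
  As usual in \<open>Graph_Theory\<close>, an undirected graph is a symmetric digraph: the edge of the
  square \<open>[j, j+1] \<times> [k, k+1]\<close> contributes both of its orientations.
\<close>

definition square_arcs :: "int \<Rightarrow> int \<Rightarrow> strip rel" where
  "square_arcs j k = {(Col j, Row k), (Row k, Col j)}"

definition K_inf_inf :: "strip pair_pre_digraph" where
  "K_inf_inf = \<lparr> pverts = range Col \<union> range Row, parcs = (\<Union>j k. square_arcs j k) \<rparr>"

definition braced_squares :: "bar set \<Rightarrow> (int \<times> int) set" where
  "braced_squares B = {(j, k). diagonals j k \<inter> B \<noteq> {}}"

text \<open>
  Only end vertices of edges are vertices of the braces graph, so a strip without any brace
  is missing from it rather than an isolated vertex.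
\<close>

definition braces_graph :: "bar set \<Rightarrow> strip pair_pre_digraph" where
  "braces_graph B =
     \<lparr> pverts = (\<Union>(j, k) \<in> braced_squares B. {Col j, Row k}),
       parcs = (\<Union>(j, k) \<in> braced_squares B. square_arcs j k) \<rparr>"

end

theory Submission
  imports Defs
begin

text \<open>
  The horizontal and vertical bars force a flex to be of the form
  \<open>u (j, k) = (f k, g j)\<close>, and either diagonal of the square \<open>(j, k)\<close> then imposes the same
  equation \<open>g (j + 1) - g j = f k - f (k + 1)\<close>. Assigning to column \<open>j\<close> the left and to
  row \<open>k\<close> the right side turns a flex, up to translation, into an arbitrary real function on the
  strips that is constant along the edges of the braces graph; rotations give the constant
  functions. So rigidity says that every function that is constant along the edges is constant,
  and this holds exactly if every strip is in the braces graph and that graph is connected.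
\<close>

section \<open>Connectedness tested by real functions on the vertices\<close>

text \<open>A function that is constant along arcs does not change along a path, in either
  direction; conversely, the indicator of a component is such a function and separates it from the
  rest. Nonemptiness is stated separately because \<open>connected\<close> includes it.\<close>

lemma (in wf_digraph) connected_iff_const:
  "Digraph_Component.connected G \<longleftrightarrow> verts G \<noteq> {} \<and>
     (\<forall>h :: 'a \<Rightarrow> real. (\<forall>e \<in> arcs G. h (tail G e) = h (head G e)) \<longrightarrow> h constant_on verts G)"
    (is "_ \<longleftrightarrow> _ \<and> ?const")
proof -
  let ?S = "mk_symmetric G"
  interpret S: pair_wf_digraph ?S by (rule wellformed_mk_symmetric)
  have "?const \<longleftrightarrow> (\<forall>u\<in>verts G. \<forall>v\<in>verts G. u \<rightarrow>\<^sup>*\<^bsub>with_proj ?S\<^esub> v)"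
  proof (intro iffI ballI)
    fix u v assume const: ?const and uv: "u \<in> verts G" "v \<in> verts G"
    \<comment> \<open>The indicator of the component of \<open>u\<close>. The symmetric closure
      holds both orientations of each arc, so reachability from \<open>u\<close> agrees at the two
      ends.\<close>
    let ?h = "indicator {w. u \<rightarrow>\<^sup>*\<^bsub>with_proj ?S\<^esub> w} :: 'a \<Rightarrow> real"
    have "?h (tail G e) = ?h (head G e)" if e: "e \<in> arcs G" for e
    proof -
      have "(tail G e, head G e) \<in> parcs ?S" "(head G e, tail G e) \<in> parcs ?S"
        using e by (auto simp: parcs_mk_symmetric)
      then have "u \<rightarrow>\<^sup>*\<^bsub>with_proj ?S\<^esub> tail G e \<longleftrightarrow> u \<rightarrow>\<^sup>*\<^bsub>with_proj ?S\<^esub> head G e"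
        by (meson S.reachable_adj_trans)
      then show ?thesis by (simp add: indicator_def)
    qed
    then have "?h constant_on verts G" using const by blast
    then have "?h u = ?h v" unfolding constant_on_def using uv by metis
    moreover have "u \<rightarrow>\<^sup>*\<^bsub>with_proj ?S\<^esub> u" using uv by simp
    ultimately show "u \<rightarrow>\<^sup>*\<^bsub>with_proj ?S\<^esub> v"
      by (simp add: indicator_def split: if_splits)
  next
    assume conn: "\<forall>u\<in>verts G. \<forall>v\<in>verts G. u \<rightarrow>\<^sup>*\<^bsub>with_proj ?S\<^esub> v"
    show ?const
    proof (intro allI impI)
      fix h :: "'a \<Rightarrow> real" assume h: "\<forall>e \<in> arcs G. h (tail G e) = h (head G e)"
      have "h u = h v" if "u \<rightarrow>\<^sup>*\<^bsub>with_proj ?S\<^esub> v" for u v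
        using that unfolding reachable_def
        by (induct rule: rtrancl_on_induct) (use h in \<open>auto simp: parcs_mk_symmetric\<close>)
      then have "\<forall>u\<in>verts G. \<forall>v\<in>verts G. h u = h v" using conn by blast
      then show "h constant_on verts G" unfolding constant_on_def by blast
    qed
  qed
  then show ?thesis
    by (simp add: connected_def strongly_connected_def)
qed

lemma braces_graph_simps:
  "pverts (braces_graph B) = (\<Union>(j, k) \<in> braced_squares B. {Col j, Row k})"
  "parcs (braces_graph B) = (\<Union>(j, k) \<in> braced_squares B. square_arcs j k)"
  by (simp_all add: braces_graph_def)

lemma pverts_K_inf_inf: "pverts K_inf_inf = UNIV"
  by (auto simp: K_inf_inf_def intro: strip.exhaust)

lemma wf_braces_graph: "wf_digraph (with_proj (braces_graph B))"
  by unfold_locales (auto simp: braces_graph_simps square_arcs_def, force+)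

lemma spanning_braces_graph_iff:
  "spanning (with_proj (braces_graph B)) (with_proj K_inf_inf) \<longleftrightarrow> pverts (braces_graph B) = UNIV"
proof -
  have "wf_digraph (with_proj K_inf_inf)"
    by unfold_locales (auto simp: pverts_K_inf_inf)
  then have "subgraph (with_proj (braces_graph B)) (with_proj K_inf_inf)"
    by (intro subgraphI compatibleI_with_proj wf_braces_graph)
      (auto simp: pverts_K_inf_inf, auto simp: braces_graph_def K_inf_inf_def)
  then show ?thesis by (auto simp: spanning_def pverts_K_inf_inf)
qed

text \<open>Demanding constancy on all strips, not just on the vertices of the braces graph, also
  rules out missing strips: the indicator of a missing strip is 0 at both ends of every edge, yet
  not constant.\<close>

lemma connected_spanning_iff:
  "Digraph_Component.connected (with_proj (braces_graph B)) \<and>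
     spanning (with_proj (braces_graph B)) (with_proj K_inf_inf) \<longleftrightarrow>
   (\<forall>h :: strip \<Rightarrow> real. (\<forall>(j, k) \<in> braced_squares B. h (Col j) = h (Row k)) \<longrightarrow> h constant_on UNIV)"
    (is "_ \<longleftrightarrow> (\<forall>h. ?bal h \<longrightarrow> _)")
proof -
  let ?G = "braces_graph B"
  have bal: "(\<forall>e \<in> parcs ?G. h (fst e) = h (snd e)) \<longleftrightarrow> ?bal h" for h :: "strip \<Rightarrow> real"
    unfolding braces_graph_simps ball_UN square_arcs_def by (auto simp: split_beta)
  have conn: "Digraph_Component.connected (with_proj ?G) \<longleftrightarrow>
      pverts ?G \<noteq> {} \<and> (\<forall>h. ?bal h \<longrightarrow> h constant_on pverts ?G)"
    by (simp add: wf_digraph.connected_iff_const[OF wf_braces_graph] bal)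
  moreover have "pverts ?G = UNIV" if const: "\<forall>h. ?bal h \<longrightarrow> h constant_on UNIV"
  proof (rule ccontr)
    assume "pverts ?G \<noteq> UNIV"
    then obtain w where w: "w \<notin> pverts ?G" by blast
    let ?h = "indicator {w} :: strip \<Rightarrow> real"
    have "?bal ?h" using w by (fastforce simp: braces_graph_simps indicator_def)
    then have "?h constant_on UNIV" using const by blast
    \<comment> \<open>Comparing \<open>w\<close> with one column and one row avoids a case
      distinction: \<open>w\<close> cannot equal both.\<close>
    then have "?h (Col 0) = ?h w \<and> ?h (Row 0) = ?h w"
      unfolding constant_on_def by (metis UNIV_I)
    then have "Col 0 = w \<and> Row 0 = w" by (simp add: indicator_def split: if_splits)
    then show False by auto
  qed
  ultimately show ?thesis unfolding spanning_braces_graph_iff by auto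
qed

section \<open>Coordinates and the bars of the unbraced grid\<close>

lemma point_nth [simp]: "point q $ 1 = of_int (fst q)" "point q $ 2 = of_int (snd q)"
  by (simp_all add: point_def)

lemma inner_real2: "(x :: real ^ 2) \<bullet> y = x $ 1 * y $ 1 + x $ 2 * y $ 2"
  by (simp add: inner_vec_def sum_2)

lemma dist_point: "dist (point p) (point q) = 1 \<longleftrightarrow>
    (fst p - fst q)\<^sup>2 + (snd p - snd q)\<^sup>2 = 1"
proof -
  \<comment> \<open>The squared distance is an integer, so unit length becomes an equation over
    \<open>int\<close>.\<close>
  have "dist (point p) (point q) = sqrt (of_int ((fst p - fst q)\<^sup>2 + (snd p - snd q)\<^sup>2))"
    by (simp add: dist_vec_def L2_set_def sum_2 dist_real_def)
  then show ?thesis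
    by (metis of_int_eq_1_iff real_sqrt_eq_1_iff)
qed

lemma int_sum_squares_eq_1:
  assumes "(a :: int)\<^sup>2 + b\<^sup>2 = 1"
  shows "\<bar>a\<bar> = 1 \<and> b = 0 \<or> a = 0 \<and> \<bar>b\<bar> = 1"
proof -
  have "\<not> 1 < \<bar>c\<bar>" if "c\<^sup>2 \<le> 1" for c :: int
    using that abs_square_le_1[of c] by simp
  moreover have "a\<^sup>2 \<le> 1" "b\<^sup>2 \<le> 1"
    using assms zero_le_power2[of a] zero_le_power2[of b] by linarith+
  ultimately have "a \<in> {-1, 0, 1}" "b \<in> {-1, 0, 1}" by force+
  then show ?thesis using assms by auto
qed

lemma grid_bars_iff:
  "{p, q} \<in> grid_bars \<longleftrightarrow>
     \<bar>fst p - fst q\<bar> = 1 \<and> snd p = snd q \<or> fst p = fst q \<and> \<bar>snd p - snd q\<bar> = 1"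
proof -
  have "{p, q} \<in> grid_bars \<longleftrightarrow> dist (point p) (point q) = 1"
    unfolding grid_bars_def mem_Collect_eq by (metis doubleton_eq_iff dist_commute)
  also have "\<dots> \<longleftrightarrow> \<bar>fst p - fst q\<bar> = 1 \<and> snd p = snd q \<or> fst p = fst q \<and> \<bar>snd p - snd q\<bar> = 1"
    unfolding dist_point
    by (auto dest!: int_sum_squares_eq_1 simp: power2_eq_1_iff abs_if split: if_splits)
  finally show ?thesis .
qed

section \<open>Flexes and rigid motions in coordinates\<close>

lemma int_const_if_step:
  assumes "\<And>n :: int. f (n + 1) = f n"
  shows "f n = f 0"
  \<comment> \<open>Induction runs both ways from 0; the shift by -1 serves the downward
    step.\<close>
  by (induction n rule: int_induct[where k = 0]) (use assms[of "_ - 1"] assms in auto)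

lemma flex_grid_bars_iff:
  "infinitesimal_flex grid_bars u \<longleftrightarrow> (\<exists>f g. u = (\<lambda>(j, k). vector [f k, g j]))"
proof
  assume flex: "infinitesimal_flex grid_bars u"
  \<comment> \<open>A unit bar along an axis makes the components of \<open>u\<close> along that
    axis agree at its ends.\<close>
  have "u (j + 1, k) $ 1 = u (j, k) $ 1" "u (j, k + 1) $ 2 = u (j, k) $ 2" for j k
    using flex[unfolded infinitesimal_flex_def, rule_format, of "(j + 1, k)" "(j, k)"]
      flex[unfolded infinitesimal_flex_def, rule_format, of "(j, k + 1)" "(j, k)"]
    by (simp_all add: grid_bars_iff inner_real2)
  then have "u (j, k) $ 1 = u (0, k) $ 1" "u (j, k) $ 2 = u (j, 0) $ 2" for j k
    using int_const_if_step[of "\<lambda>j. u (j, k) $ 1"] int_const_if_step[of "\<lambda>k. u (j, k) $ 2"]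
    by blast+
  then have "u = (\<lambda>(j, k). vector [u (0, k) $ 1, u (j, 0) $ 2])"
    by (auto simp: fun_eq_iff vec_eq_iff forall_2)
  then show "\<exists>f g. u = (\<lambda>(j, k). vector [f k, g j])" by (intro exI)
next
  assume "\<exists>f g. u = (\<lambda>(j, k). vector [f k, g j])"
  then show "infinitesimal_flex grid_bars u"
    by (auto simp: infinitesimal_flex_def grid_bars_iff inner_real2)
qed

text \<open>The diagonals have directions (1, 1) and (1, -1); passing to the other one reverses the
  \<open>f\<close> difference together with the sign of its partner, so the equation is the same. By
  \<open>B\<close>, every bar lies in some square, whose equation then settles that bar.\<close>

lemma flex_braces_iff:
  assumes B: "B \<subseteq> (\<Union>j k. diagonals j k)"
  shows "infinitesimal_flex B (\<lambda>(j, k). vector [f k, g j]) \<longleftrightarrow>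
    (\<forall>(j, k) \<in> braced_squares B. g (j + 1) - g j = f k - f (k + 1))"
proof -
  let ?u = "\<lambda>(j, k). vector [f k, g j] :: real ^ 2"
  have diag: "(?u p - ?u q) \<bullet> (point p - point q) = 0 \<longleftrightarrow> g (j + 1) - g j = f k - f (k + 1)"
    if "{p, q} \<in> diagonals j k" for p q j k
    using that by (auto simp: diagonals_def doubleton_eq_iff inner_real2)
  have squares: "(j, k) \<in> braced_squares B \<longleftrightarrow> (\<exists>p q. {p, q} \<in> diagonals j k \<and> {p, q} \<in> B)"
    for j k
    unfolding braced_squares_def diagonals_def by blast
  have cover: "\<exists>j k. {p, q} \<in> diagonals j k" if "{p, q} \<in> B" for p q
    using that B by blast
  show ?thesis
  proof
    assume flex: "infinitesimal_flex B ?u"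
    show "\<forall>(j, k) \<in> braced_squares B. g (j + 1) - g j = f k - f (k + 1)"
    proof clarify
      fix j k assume "(j, k) \<in> braced_squares B"
      then obtain p q where "{p, q} \<in> diagonals j k" "{p, q} \<in> B" unfolding squares by blast
      then show "g (j + 1) - g j = f k - f (k + 1)"
        using flex unfolding infinitesimal_flex_def by (intro diag[THEN iffD1]) blast+
    qed
  next
    assume eq: "\<forall>(j, k) \<in> braced_squares B. g (j + 1) - g j = f k - f (k + 1)"
    show "infinitesimal_flex B ?u"
      unfolding infinitesimal_flex_def
    proof (intro allI impI)
      fix p q assume pq: "{p, q} \<in> B"
      then obtain j k where jk: "{p, q} \<in> diagonals j k" using cover by blast
      then have "(j, k) \<in> braced_squares B" using pq unfolding squares by blast
      then show "(?u p - ?u q) \<bullet> (point p - point q) = 0" using eq diag[OF jk] by blast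
    qed
  qed
qed

lemma flex_un_iff:
  "infinitesimal_flex (E \<union> F) u \<longleftrightarrow> infinitesimal_flex E u \<and> infinitesimal_flex F u"
  unfolding infinitesimal_flex_def by blast

lemma int_affine_if_step:
  fixes f :: "int \<Rightarrow> real"
  assumes "\<And>n. f (n + 1) - f n = c"
  shows "f n = f 0 + c * of_int n"
proof -
  \<comment> \<open>Removing the linear part leaves a function with zero increments.\<close>
  have "f (n + 1) - c * of_int (n + 1) = f n - c * of_int n" for n
    using assms[of n] by (simp add: algebra_simps)
  from int_const_if_step[of "\<lambda>n. f n - c * of_int n" n, OF this] show ?thesis
    by (simp add: algebra_simps)
qed

text \<open>The rotation field at (j, k) is \<open>c\<close> times (-k, j), so \<open>g\<close> has
  slope \<open>c\<close> and \<open>f\<close> slope \<open>-c\<close>; the translation supplies the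
  values at 0.\<close>

lemma rigid_motion_flex_iff:
  "rigid_motion_flex (\<lambda>(j, k). vector [f k, g j]) \<longleftrightarrow>
     (\<exists>c. (\<forall>j. g (j + 1) - g j = c) \<and> (\<forall>k. f k - f (k + 1) = c))"
proof
  assume "rigid_motion_flex (\<lambda>(j, k). vector [f k, g j])"
  then obtain a c where u: "\<And>j k. vector [f k, g j] = a + c *\<^sub>R rot90 (point (j, k))"
    unfolding rigid_motion_flex_def by auto
  have fg: "f k = a $ 1 - c * of_int k" "g j = a $ 2 + c * of_int j" for j k
    using u[of k j] by (auto simp: vec_eq_iff forall_2 rot90_def)
  then show "\<exists>c. (\<forall>j. g (j + 1) - g j = c) \<and> (\<forall>k. f k - f (k + 1) = c)"
    by (intro exI[of _ c]) (simp add: fg algebra_simps)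
next
  assume "\<exists>c. (\<forall>j. g (j + 1) - g j = c) \<and> (\<forall>k. f k - f (k + 1) = c)"
  then obtain c where c: "\<And>j. g (j + 1) - g j = c" "\<And>k. f k - f (k + 1) = c" by blast
  have "f (k + 1) - f k = - c" for k using c(2)[of k] by simp
  note affine = int_affine_if_step[of g, OF c(1)] int_affine_if_step[of f, OF this]
  have "(\<lambda>(j, k). vector [f k, g j]) q = vector [f 0, g 0] + c *\<^sub>R rot90 (point q)" for q
    using affine(1)[of "fst q"] affine(2)[of "snd q"]
    by (simp add: split_beta vec_eq_iff forall_2 rot90_def)
  then show "rigid_motion_flex (\<lambda>(j, k). vector [f k, g j])"
    unfolding rigid_motion_flex_def by blast
qed

text \<open>This makes every function on the strips arise from a flex of the grid.\<close>

lemma int_antidifference: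
  fixes h :: "int \<Rightarrow> real"
  obtains F where "\<And>n. F (n + 1) - F n = h n"
proof
  \<comment> \<open>The signed sum from 0 to \<open>n\<close>: one of the two intervals is always
    empty, and both are at 0, so the step from -1 to 0 fits the negative case.\<close>
  let ?F = "\<lambda>n. sum h {0..<n} - sum h {n..<0}"
  show "?F (n + 1) - ?F n = h n" for n
  proof (cases "0 \<le> n")
    case True
    then have "{0..<n + 1} = insert n {0..<n}" by auto
    then show ?thesis using True by simp
  next
    case False
    then have "{n..<0} = insert n {n + 1..<0}" by auto
    then show ?thesis using False by simp
  qed
qed

section \<open>Translating rigidity into constancy on strips\<close>

theorem theorem4p2:
  fixes B :: "bar set"
  assumes "B \<subseteq> (\<Union>j k. diagonals j k)"
  shows "infinitesimally_rigid (braced_grid B) \<longleftrightarrow>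
           Digraph_Component.connected (with_proj (braces_graph B)) \<and>
           spanning (with_proj (braces_graph B)) (with_proj K_inf_inf)"
proof -
  let ?bal = "\<lambda>a b. \<forall>(j, k) \<in> braced_squares B. a j = (b k :: real)"
  \<comment> \<open>The grid bars parametrise the flexes by \<open>f\<close> and \<open>g\<close>;
    the premise is the condition from the braces, the conclusion that of a rigid motion.\<close>
  have "infinitesimally_rigid (braced_grid B) \<longleftrightarrow>
      (\<forall>f g. ?bal (\<lambda>j. g (j + 1) - g j) (\<lambda>k. f k - f (k + 1)) \<longrightarrow>
         (\<exists>c. (\<forall>j. g (j + 1) - g j = c) \<and> (\<forall>k. f k - f (k + 1) = c)))"
    unfolding infinitesimally_rigid_def braced_grid_def flex_un_iff flex_grid_bars_iff
      flex_braces_iff[OF assms, symmetric] rigid_motion_flex_iff[symmetric]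
    by blast
  also have "\<dots> \<longleftrightarrow> (\<forall>h. ?bal (\<lambda>j. h (Col j)) (\<lambda>k. h (Row k)) \<longrightarrow> h constant_on UNIV)"
  proof (intro iffI allI impI)
    fix h :: "strip \<Rightarrow> real"
    assume rigid: "\<forall>f g. ?bal (\<lambda>j. g (j + 1) - g j) (\<lambda>k. f k - f (k + 1)) \<longrightarrow>
         (\<exists>c. (\<forall>j. g (j + 1) - g j = c) \<and> (\<forall>k. f k - f (k + 1) = c))"
      and bal: "?bal (\<lambda>j. h (Col j)) (\<lambda>k. h (Row k))"
    obtain g where g: "\<And>j. g (j + 1) - g j = h (Col j)"
      using int_antidifference[of "\<lambda>j. h (Col j)"] by blast
    \<comment> \<open>Rows carry the backward difference of \<open>f\<close>, hence the minus
      sign.\<close>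
    obtain f where "\<And>k. f (k + 1) - f k = - h (Row k)"
      using int_antidifference[of "\<lambda>k. - h (Row k)"] by blast
    then have f: "f k - f (k + 1) = h (Row k)" for k by (metis minus_diff_eq minus_minus)
    obtain c where "\<And>j. h (Col j) = c" "\<And>k. h (Row k) = c"
      using rigid[rule_format, of g f] bal unfolding f g by blast
    then show "h constant_on UNIV" unfolding constant_on_def by (metis strip.exhaust)
  next
    fix f g :: "int \<Rightarrow> real"
    assume const: "\<forall>h. ?bal (\<lambda>j. h (Col j)) (\<lambda>k. h (Row k)) \<longrightarrow> h constant_on UNIV"
      and bal: "?bal (\<lambda>j. g (j + 1) - g j) (\<lambda>k. f k - f (k + 1))"
    \<comment> \<open>Both difference functions are glued into one function on the strips.\<close>
    have "case_strip (\<lambda>j. g (j + 1) - g j) (\<lambda>k. f k - f (k + 1)) constant_on UNIV"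
      using bal by (intro const[rule_format]) simp
    then obtain c where
      "\<And>s. case_strip (\<lambda>j. g (j + 1) - g j) (\<lambda>k. f k - f (k + 1)) s = c"
      unfolding constant_on_def by blast
    from this[of "Col _"] this[of "Row _"]
    show "\<exists>c. (\<forall>j. g (j + 1) - g j = c) \<and> (\<forall>k. f k - f (k + 1) = c)" by auto
  qed
  also have "\<dots> \<longleftrightarrow> Digraph_Component.connected (with_proj (braces_graph B)) \<and>
           spanning (with_proj (braces_graph B)) (with_proj K_inf_inf)"
    by (rule connected_spanning_iff[symmetric])
  finally show ?thesis .
qed

end
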